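(* Let $(X,d)$ be a complete metric space or a complete ultrametric space (with $X$ nonempty), and let $\varphi\colon\mathbb{R}_+\to\mathbb{R}_+$ be a comparison function. If $(T_n)_{n\in\mathbb{N}}$ is a sequence of $\varphi$-contractions $T_n\colon X\to X$ converging pointwise to a mapping $T\colon X\to X$, then $T$ is a $\varphi$-contraction, and the sequence of the fixed points of the mappings $T_n$ converges to the fixed point of $T$.
   Context: $\mathbb{R}_+=[0,\infty)$. A comparison function is a monotone increasing (i.e. nondecreasing) function $\varphi\colon\mathbb{R}_+\to\mathbb{R}_+$ such that $\lim_{n\to\infty}\varphi^n(t)=0$ for all $t\ge 0$, where $\varphi^n$ is the $n$-th iterate. Given a comparison function $\varphi$, a mapping $T\colon X\to X$ is a $\varphi$-contraction if $d(Tx,Ty)\le\varphi(d(x,y))$ for all $x,y\in X$. In a nonempty complete metric (in particular, ultrametric) space every $\varphi$-contraction has a unique fixed point, so the fixed points mentioned in the claim exist and are unique. *)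

theory Defs
  imports "HOL-Analysis.Analysis"
begin

locale Ultrametric_space = Metric_space +
  assumes ultra_triangle: "\<lbrakk>x \<in> M; y \<in> M; z \<in> M\<rbrakk> \<Longrightarrow> d x z \<le> max (d x y) (d y z)"

(* Functions on the nonnegative reals are modelled as functions on all reals,
   constrained on {0..} only. *)
definition comparison_function :: "(real \<Rightarrow> real) \<Rightarrow> bool" where
  "comparison_function \<phi> \<longleftrightarrow>
     \<phi> \<in> {0..} \<rightarrow> {0..} \<and> mono_on {0..} \<phi> \<and>
     (\<forall>t\<ge>0. (\<lambda>n. (\<phi> ^^ n) t) \<longlonglongrightarrow> 0)"

definition phi_contraction ::
    "'a set \<Rightarrow> ('a \<Rightarrow> 'a \<Rightarrow> real) \<Rightarrow> (real \<Rightarrow> real) \<Rightarrow> ('a \<Rightarrow> 'a) \<Rightarrow> bool" where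
  "phi_contraction X d \<phi> T \<longleftrightarrow>
     T \<in> X \<rightarrow> X \<and> (\<forall>x\<in>X. \<forall>y\<in>X. d (T x) (T y) \<le> \<phi> (d x y))"

(* Meaningful only when T has exactly one fixed point in X. *)
definition the_fixed_point :: "'a set \<Rightarrow> ('a \<Rightarrow> 'a) \<Rightarrow> 'a" where
  "the_fixed_point X T = (THE x. x \<in> X \<and> T x = x)"

end

theory Submission
  imports Defs
begin

text \<open>
  Any comparison function satisfies \<open>\<phi> t < t\<close> for \<open>t > 0\<close>, so each radius \<open>\<epsilon> > 0\<close> leaves a
  positive gap \<open>\<epsilon> - \<phi> \<epsilon>\<close>.  If a \<open>\<phi>\<close>-contraction \<open>f\<close> displaces a point \<open>x\<close> by at most this
  gap, then \<open>f\<close> maps the closed ball of radius \<open>\<epsilon>\<close> about \<open>x\<close> into itself, and hence the whole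
  orbit of \<open>x\<close> stays in that ball (\<open>phi_orbit_in_ball\<close>).  This trapping principle is used twice.

  It yields the fixed points: displacements along an orbit are dominated by the iterates of \<open>\<phi>\<close>
  and tend to \<open>0\<close>, so the tails of the orbit are trapped in arbitrarily small balls and the orbit
  is Cauchy (\<open>phi_orbit_MCauchy\<close>); its limit is a fixed point.

  It also yields their stability: orbits converge to the fixed point, so the fixed point of a
  \<open>\<phi>\<close>-contraction lies in every closed ball that traps the orbit of its centre
  (\<open>phi_fixed_point_near\<close>).  If \<open>a\<close> is the fixed point of the pointwise limit \<open>T\<close>, then the
  displacement of \<open>a\<close> under the \<open>n\<close>-th mapping tends to \<open>d (T a) a = 0\<close>.  As the gap
  \<open>\<epsilon> - \<phi> \<epsilon>\<close> depends on \<open>\<phi>\<close> alone, and all the mappings share \<open>\<phi>\<close>, their fixed points are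
  eventually within \<open>\<epsilon>\<close> of \<open>a\<close>.
\<close>

section \<open>Comparison functions\<close>

lemma comparison_iterates_nonneg:
  assumes "comparison_function \<phi>" "0 \<le> t"
  shows "0 \<le> (\<phi> ^^ n) t"
  using assms by (induction n) (auto simp: comparison_function_def Pi_iff)

text \<open>
  If \<open>t \<le> \<phi> t\<close>, monotonicity keeps every iterate above \<open>t\<close>, which contradicts convergence
  to \<open>0\<close>.
\<close>
lemma comparison_less_self:
  assumes \<phi>: "comparison_function \<phi>" and t: "0 < t"
  shows "\<phi> t < t"
proof (rule ccontr)
  assume "\<not> \<phi> t < t"
  then have le: "t \<le> \<phi> t" by simp
  have "t \<le> (\<phi> ^^ n) t" for n
  proof (induction n)
    case (Suc n)
    have "\<phi> t \<le> \<phi> ((\<phi> ^^ n) t)"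
      using \<phi> t Suc by (auto simp: comparison_function_def intro: mono_onD)
    then show ?case using le by simp
  qed simp
  moreover have "(\<lambda>n. (\<phi> ^^ n) t) \<longlonglongrightarrow> 0"
    using \<phi> t by (auto simp: comparison_function_def)
  ultimately have "t \<le> 0" by (meson LIMSEQ_le_const)
  then show False using t by simp
qed

text \<open>
  At the boundary point: a value \<open>\<phi> 0 > 0\<close> would satisfy \<open>\<phi> (\<phi> 0) \<ge> \<phi> 0\<close> by monotonicity,
  against the strict inequality at positive arguments.
\<close>
lemma comparison_le_self:
  assumes \<phi>: "comparison_function \<phi>" and t: "0 \<le> t"
  shows "\<phi> t \<le> t"
proof (cases "t = 0")
  case True
  have nn: "0 \<le> \<phi> 0" using \<phi> by (auto simp: comparison_function_def)
  then have "\<phi> 0 \<le> \<phi> (\<phi> 0)"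
    using \<phi> by (auto simp: comparison_function_def intro: mono_onD)
  then show ?thesis
    using comparison_less_self[OF \<phi>, of "\<phi> 0"] nn True by fastforce
next
  case False
  then show ?thesis using comparison_less_self[OF \<phi>, of t] t by simp
qed

section \<open>Orbits of contractions\<close>

context Metric_space
begin

lemma phi_iterate_in:
  assumes "phi_contraction M d \<phi> f" "x \<in> M"
  shows "(f ^^ n) x \<in> M"
  using assms by (induction n) (auto simp: phi_contraction_def)

lemma phi_iterates_dist:
  assumes \<phi>: "comparison_function \<phi>" and f: "phi_contraction M d \<phi> f"
    and x: "x \<in> M" and y: "y \<in> M"
  shows "d ((f ^^ n) x) ((f ^^ n) y) \<le> (\<phi> ^^ n) (d x y)"
proof (induction n)
  case (Suc n)
  have "d ((f ^^ Suc n) x) ((f ^^ Suc n) y) \<le> \<phi> (d ((f ^^ n) x) ((f ^^ n) y))"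
    using f phi_iterate_in[OF f] x y by (simp add: phi_contraction_def)
  also have "\<dots> \<le> \<phi> ((\<phi> ^^ n) (d x y))"
    using \<phi> Suc comparison_iterates_nonneg[OF \<phi>]
    by (auto simp: comparison_function_def intro: mono_onD)
  finally show ?case by simp
qed simp

lemma phi_iterates_dist_tendsto_0:
  assumes \<phi>: "comparison_function \<phi>" and f: "phi_contraction M d \<phi> f"
    and x: "x \<in> M" and y: "y \<in> M"
  shows "(\<lambda>n. d ((f ^^ n) x) ((f ^^ n) y)) \<longlonglongrightarrow> 0"
proof (rule tendsto_sandwich[OF _ _ tendsto_const])
  show "(\<lambda>n. (\<phi> ^^ n) (d x y)) \<longlonglongrightarrow> 0"
    using \<phi> by (simp add: comparison_function_def)
qed (simp_all add: phi_iterates_dist[OF assms])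

text \<open>
  The closed ball is invariant: for \<open>y\<close> in it, the displacement of the centre costs at most
  \<open>\<epsilon> - \<phi> \<epsilon>\<close>, and the distance between the images of the centre and of \<open>y\<close> at most \<open>\<phi> \<epsilon>\<close>.
\<close>
lemma phi_orbit_in_ball:
  assumes \<phi>: "comparison_function \<phi>" and f: "phi_contraction M d \<phi> f"
    and x: "x \<in> M" and \<epsilon>: "0 \<le> \<epsilon>" and gap: "d x (f x) \<le> \<epsilon> - \<phi> \<epsilon>"
  shows "d x ((f ^^ n) x) \<le> \<epsilon>"
proof (induction n)
  case 0
  then show ?case using x \<epsilon> by simp
next
  case (Suc n)
  let ?y = "(f ^^ n) x"
  have y: "?y \<in> M" and fx: "f x \<in> M" and fy: "f ?y \<in> M"
    using phi_iterate_in[OF f x, of n] f x by (auto simp: phi_contraction_def)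
  have "d (f x) (f ?y) \<le> \<phi> (d x ?y)"
    using f x y by (simp add: phi_contraction_def)
  also have "\<dots> \<le> \<phi> \<epsilon>"
    using \<phi> Suc \<epsilon> by (auto simp: comparison_function_def intro: mono_onD)
  finally show ?case
    using triangle[OF x fx fy] gap by simp
qed

lemma phi_orbit_MCauchy:
  assumes \<phi>: "comparison_function \<phi>" and f: "phi_contraction M d \<phi> f" and x: "x \<in> M"
  shows "MCauchy (\<lambda>n. (f ^^ n) x)"
  unfolding MCauchy_def
proof (intro conjI allI impI)
  show "range (\<lambda>n. (f ^^ n) x) \<subseteq> M" using phi_iterate_in[OF f x] by auto
next
  fix \<epsilon> :: real assume "0 < \<epsilon>"
  \<comment> \<open>Two points of the trapped tail are at most twice the radius apart, so a third of \<open>\<epsilon>\<close>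
      makes their distance strictly less than \<open>\<epsilon>\<close>.\<close>
  define \<delta> where "\<delta> = \<epsilon> / 3"
  have \<delta>: "0 < \<delta>" using \<open>0 < \<epsilon>\<close> by (simp add: \<delta>_def)
  then have pos: "0 < \<delta> - \<phi> \<delta>" using comparison_less_self[OF \<phi>] by simp
  have fx: "f x \<in> M" using f x by (auto simp: phi_contraction_def)
  have "\<forall>\<^sub>F n in sequentially. d ((f ^^ n) x) ((f ^^ n) (f x)) < \<delta> - \<phi> \<delta>"
    by (rule order_tendstoD(2)[OF phi_iterates_dist_tendsto_0[OF \<phi> f x fx] pos])
  then obtain N where "d ((f ^^ N) x) ((f ^^ N) (f x)) < \<delta> - \<phi> \<delta>"
    by (auto simp: eventually_sequentially)
  then have gap: "d ((f ^^ N) x) (f ((f ^^ N) x)) \<le> \<delta> - \<phi> \<delta>"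
    by (simp add: funpow_swap1)
  have N: "(f ^^ N) x \<in> M" by (rule phi_iterate_in[OF f x])
  have tail: "d ((f ^^ N) x) ((f ^^ n) x) \<le> \<delta>" if "N \<le> n" for n
  proof -
    have "(f ^^ n) x = (f ^^ (n - N)) ((f ^^ N) x)"
      using that by (metis comp_apply funpow_add le_add_diff_inverse2)
    then show ?thesis
      using phi_orbit_in_ball[OF \<phi> f N _ gap] \<delta> by simp
  qed
  have "d ((f ^^ n) x) ((f ^^ m) x) < \<epsilon>" if "N \<le> n" "N \<le> m" for n m
    using triangle'[OF phi_iterate_in[OF f x, of n] N phi_iterate_in[OF f x, of m]]
      tail[OF that(1)] tail[OF that(2)] \<delta>
    by (simp add: \<delta>_def commute)
  then show "\<exists>N. \<forall>n n'. N \<le> n \<longrightarrow> N \<le> n' \<longrightarrow> d ((f ^^ n) x) ((f ^^ n') x) < \<epsilon>"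
    by blast
qed

section \<open>Fixed points\<close>

text \<open>
  Uniqueness: two fixed points are fixed by all iterates of \<open>f\<close>, yet the distance between the
  iterates of any two points tends to \<open>0\<close>.  Existence: \<open>f\<close> is nonexpansive, hence continuous,
  so the limit of an orbit is fixed.
\<close>
theorem phi_contraction_ex1_fixed_point:
  assumes complete: "mcomplete" and nonempty: "M \<noteq> {}"
    and \<phi>: "comparison_function \<phi>" and f: "phi_contraction M d \<phi> f"
  shows "\<exists>!x. x \<in> M \<and> f x = x"
proof -
  obtain x where x: "x \<in> M" using nonempty by auto
  obtain a where lim: "limitin mtopology (\<lambda>n. (f ^^ n) x) a sequentially"
    using complete phi_orbit_MCauchy[OF \<phi> f x] unfolding mcomplete_def by blast
  then have a: "a \<in> M" and dlim: "(\<lambda>n. d ((f ^^ n) x) a) \<longlonglongrightarrow> 0"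
    by (auto simp: limitin_metric_dist_null)
  have fa: "f a \<in> M" using f a by (auto simp: phi_contraction_def)
  have "d (f ((f ^^ n) x)) (f a) \<le> d ((f ^^ n) x) a" for n
    using f phi_iterate_in[OF f x, of n] a comparison_le_self[OF \<phi>, of "d ((f ^^ n) x) a"]
    by (force simp: phi_contraction_def)
  then have "(\<lambda>n. d ((f ^^ Suc n) x) (f a)) \<longlonglongrightarrow> 0"
    by (intro tendsto_sandwich[OF _ _ tendsto_const dlim]) simp_all
  then have "limitin mtopology (\<lambda>n. (f ^^ Suc n) x) (f a) sequentially"
    using fa phi_iterate_in[OF f x] by (simp only: limitin_metric_dist_null) simp
  moreover have "limitin mtopology (\<lambda>n. (f ^^ Suc n) x) a sequentially"
    using limitin_subsequence[OF _ lim, of Suc] by (simp add: comp_def strict_mono_def)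
  ultimately have a_fixed: "f a = a"
    using limitin_metric_unique trivial_limit_sequentially by blast
  show ?thesis
  proof (rule ex1I[of _ a])
    fix b assume b: "b \<in> M \<and> f b = b"
    have "(f ^^ n) a = a" "(f ^^ n) b = b" for n
      using a_fixed b by (induction n) auto
    then have "(\<lambda>n. d b a) \<longlonglongrightarrow> 0"
      using phi_iterates_dist_tendsto_0[OF \<phi> f, of b a] a b by simp
    then show "b = a" using a b by (simp add: LIMSEQ_const_iff)
  qed (use a a_fixed in auto)
qed

text \<open>
  Orbits approach \<open>b\<close>, and the orbit of \<open>x\<close> never leaves the closed ball, so \<open>b\<close> belongs to
  that ball.
\<close>
lemma phi_fixed_point_near:
  assumes \<phi>: "comparison_function \<phi>" and f: "phi_contraction M d \<phi> f"
    and b: "b \<in> M" "f b = b"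
    and x: "x \<in> M" and \<epsilon>: "0 \<le> \<epsilon>" and gap: "d x (f x) \<le> \<epsilon> - \<phi> \<epsilon>"
  shows "d b x \<le> \<epsilon>"
proof (rule LIMSEQ_le_const)
  have fixed: "(f ^^ n) b = b" for n
    using b by (induction n) auto
  show "(\<lambda>n. d ((f ^^ n) b) ((f ^^ n) x) + \<epsilon>) \<longlonglongrightarrow> \<epsilon>"
    using tendsto_add[OF phi_iterates_dist_tendsto_0[OF \<phi> f b(1) x] tendsto_const, of \<epsilon>]
    by simp
  have "d b x \<le> d ((f ^^ n) b) ((f ^^ n) x) + \<epsilon>" for n
    using triangle[OF b(1) phi_iterate_in[OF f x, of n] x]
      phi_orbit_in_ball[OF \<phi> f x \<epsilon> gap, of n]
    by (simp add: fixed commute)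
  then show "\<exists>N. \<forall>n\<ge>N. d b x \<le> d ((f ^^ n) b) ((f ^^ n) x) + \<epsilon>" by blast
qed

section \<open>Pointwise limits\<close>

lemma phi_contraction_pointwise_limit:
  assumes f: "\<And>n. phi_contraction M d \<phi> (f n)" and self_map: "g \<in> M \<rightarrow> M"
    and lim: "\<And>x. x \<in> M \<Longrightarrow> limitin mtopology (\<lambda>n. f n x) (g x) sequentially"
  shows "phi_contraction M d \<phi> g"
  unfolding phi_contraction_def
proof (intro conjI ballI self_map)
  fix x y assume x: "x \<in> M" and y: "y \<in> M"
  have dlim: "(\<lambda>n. d (f n z) (g z)) \<longlonglongrightarrow> 0" if "z \<in> M" for z
    using lim[OF that] by (simp add: limitin_metric_dist_null)
  have "(\<lambda>n. d (f n x) (g x) + \<phi> (d x y) + d (f n y) (g y)) \<longlonglongrightarrow> 0 + \<phi> (d x y) + 0"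
    by (intro tendsto_intros dlim x y)
  moreover have "d (g x) (g y) \<le> d (f n x) (g x) + \<phi> (d x y) + d (f n y) (g y)" for n
  proof -
    have fx: "f n x \<in> M" and fy: "f n y \<in> M" and gx: "g x \<in> M" and gy: "g y \<in> M"
      and le: "d (f n x) (f n y) \<le> \<phi> (d x y)"
      using f[of n] self_map x y by (auto simp: phi_contraction_def)
    show ?thesis
      using triangle[OF gx fx gy] triangle[OF fx fy gy] le by (simp add: commute)
  qed
  ultimately show "d (g x) (g y) \<le> \<phi> (d x y)"
    by (intro LIMSEQ_le_const[where X = "\<lambda>n. d (f n x) (g x) + \<phi> (d x y) + d (f n y) (g y)"])
      auto
qed

text \<open>
  The admissible displacement \<open>\<epsilon> - \<phi> \<epsilon>\<close> is the same for every \<open>n\<close>, so for all large \<open>n\<close>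
  the point \<open>a\<close>, which is almost fixed by \<open>f n\<close>, is close to the true fixed point \<open>b n\<close>.
\<close>
lemma phi_fixed_points_tendsto:
  assumes \<phi>: "comparison_function \<phi>" and f: "\<And>n. phi_contraction M d \<phi> (f n)"
    and b: "\<And>n. b n \<in> M" "\<And>n. f n (b n) = b n"
    and lim: "limitin mtopology (\<lambda>n. f n a) a sequentially"
  shows "limitin mtopology b a sequentially"
  unfolding limitin_metric
proof (intro conjI allI impI)
  show a: "a \<in> M" using lim by (simp add: limitin_metric)
  fix \<epsilon> :: real assume "0 < \<epsilon>"
  \<comment> \<open>Trapping gives a non-strict bound; half the radius makes it strict.\<close>
  define \<delta> where "\<delta> = \<epsilon> / 2"
  have \<delta>: "0 < \<delta>" "\<delta> < \<epsilon>" using \<open>0 < \<epsilon>\<close> by (simp_all add: \<delta>_def)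
  have "0 < \<delta> - \<phi> \<delta>" using comparison_less_self[OF \<phi> \<delta>(1)] by simp
  then have "\<forall>\<^sub>F n in sequentially. f n a \<in> M \<and> d (f n a) a < \<delta> - \<phi> \<delta>"
    using lim by (simp add: limitin_metric)
  then show "\<forall>\<^sub>F n in sequentially. b n \<in> M \<and> d (b n) a < \<epsilon>"
  proof eventually_elim
    case (elim n)
    then have "d a (f n a) \<le> \<delta> - \<phi> \<delta>" by (simp add: commute)
    then have "d (b n) a \<le> \<delta>"
      using phi_fixed_point_near[OF \<phi> f b a] \<delta> by simp
    then show ?case using b \<delta> by simp
  qed
qed

end

lemma the_fixed_point_fixed:
  assumes "\<exists>!x. x \<in> X \<and> T x = x"
  shows "the_fixed_point X T \<in> X" "T (the_fixed_point X T) = the_fixed_point X T"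
  using theI'[OF assms] by (auto simp: the_fixed_point_def)

theorem corollary2:
  fixes X :: "'a set" and d :: "'a \<Rightarrow> 'a \<Rightarrow> real"
    and \<phi> :: "real \<Rightarrow> real"
    and Tn :: "nat \<Rightarrow> 'a \<Rightarrow> 'a" and T :: "'a \<Rightarrow> 'a"
  assumes space: "Metric_space X d \<or> Ultrametric_space X d"
    and complete: "Metric_space.mcomplete X d"
    and nonempty: "X \<noteq> {}"
    and comparison: "comparison_function \<phi>"
    and contractions: "\<And>n. phi_contraction X d \<phi> (Tn n)"
    and self_map: "T \<in> X \<rightarrow> X"
    and pointwise:
      "\<And>x. x \<in> X \<Longrightarrow> limitin (Metric_space.mtopology X d) (\<lambda>n. Tn n x) (T x) sequentially"
  shows "phi_contraction X d \<phi> T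
    \<and> (\<forall>n. \<exists>!x. x \<in> X \<and> Tn n x = x)
    \<and> (\<exists>!x. x \<in> X \<and> T x = x)
    \<and> limitin (Metric_space.mtopology X d)
        (\<lambda>n. the_fixed_point X (Tn n)) (the_fixed_point X T) sequentially"
proof -
  interpret Metric_space X d
    using space by (auto simp: Ultrametric_space_def)
  have T: "phi_contraction X d \<phi> T"
    by (rule phi_contraction_pointwise_limit[OF contractions self_map pointwise])
  note ex1 = phi_contraction_ex1_fixed_point[OF complete nonempty comparison]
  note fixed_T = the_fixed_point_fixed[OF ex1[OF T]]
  have "limitin mtopology (\<lambda>n. the_fixed_point X (Tn n)) (the_fixed_point X T) sequentially"
  proof (rule phi_fixed_points_tendsto[OF comparison contractions])
    show "limitin mtopology (\<lambda>n. Tn n (the_fixed_point X T)) (the_fixed_point X T) sequentially"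
      using pointwise[OF fixed_T(1)] fixed_T(2) by simp
  qed (rule the_fixed_point_fixed[OF ex1[OF contractions]])+
  then show ?thesis using T ex1[OF T] ex1[OF contractions] by simp
qed

end
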